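(* Let $(U_A,\tau)$ be a soft topological space and $G_A$ any soft set over $U$. The following are equivalent: (i) $G_A$ is a semiclosed soft set; (ii) $(\overline{G_A})^0\subseteq G_A$; (iii) $\overline{(G_A^c)^0}\supseteq G_A^c$; (iv) $G_A^c$ is a semiopen soft set.
   Context: Soft sets. Fix a universe $U$ and a parameter set $A$. A soft set $F_A$ over $U$ is a map $F:A\to\mathcal P(U)$; $SS(U)_A$ is the set of all of them. $\Phi_A$ (null soft set) has all values $\emptyset$; $U_A$ has all values $U$. Soft inclusion, union, intersection and complement ($(F_A)^c$) are taken parameterwise. Soft topology. A soft topology is a family $\tau\subseteq SS(U)_A$ containing $\Phi_A,U_A$, closed under arbitrary soft unions and under soft intersections of two members; $(U_A,\tau)$ is then a soft topological space. Members of $\tau$ are the open soft sets, their complements the closed soft sets. $\overline{F_A}$ is the intersection of all closed soft sets containing $F_A$, and $(F_A)^0$ is the union of all open soft sets contained in $F_A$. A soft set $G_A$ is semiopen if there is an open soft set $H_A$ with $H_A\subseteq G_A\subseteq\overline{H_A}$; a soft set $F_A$ is semiclosed if there is a closed soft set $K_A$ with $(K_A)^0\subseteq F_A\subseteq K_A$. *)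

theory Defs
  imports Main "HOL-Library.FuncSet"
begin

text \<open>
  The universe \<open>U\<close> and the parameter set \<open>A\<close> are arbitrary, possibly empty, sets. Soft sets are
  extensional functions on \<open>A\<close>, so that equality of soft sets is equality of maps
  from \<open>A\<close> to the powerset of \<open>U\<close>.
\<close>

definition soft_sets :: "'u set \<Rightarrow> 'a set \<Rightarrow> ('a \<Rightarrow> 'u set) set" where
  "soft_sets U A = A \<rightarrow>\<^sub>E Pow U"

definition null_soft :: "'a set \<Rightarrow> 'a \<Rightarrow> 'u set" where
  "null_soft A = (\<lambda>p\<in>A. {})"

definition full_soft :: "'u set \<Rightarrow> 'a set \<Rightarrow> 'a \<Rightarrow> 'u set" where
  "full_soft U A = (\<lambda>p\<in>A. U)"

definition soft_subset :: "'a set \<Rightarrow> ('a \<Rightarrow> 'u set) \<Rightarrow> ('a \<Rightarrow> 'u set) \<Rightarrow> bool" where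
  "soft_subset A F G \<longleftrightarrow> (\<forall>p\<in>A. F p \<subseteq> G p)"

definition soft_inter :: "'a set \<Rightarrow> ('a \<Rightarrow> 'u set) \<Rightarrow> ('a \<Rightarrow> 'u set) \<Rightarrow> 'a \<Rightarrow> 'u set" where
  "soft_inter A F G = (\<lambda>p\<in>A. F p \<inter> G p)"

definition soft_compl :: "'u set \<Rightarrow> 'a set \<Rightarrow> ('a \<Rightarrow> 'u set) \<Rightarrow> 'a \<Rightarrow> 'u set" where
  "soft_compl U A F = (\<lambda>p\<in>A. U - F p)"

definition soft_Union :: "'a set \<Rightarrow> ('a \<Rightarrow> 'u set) set \<Rightarrow> 'a \<Rightarrow> 'u set" where
  "soft_Union A \<F> = (\<lambda>p\<in>A. \<Union>F\<in>\<F>. F p)"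

text \<open>The intersection is taken inside \<open>U\<close>, so the empty family has intersection \<open>full_soft U A\<close>.\<close>

definition soft_Inter :: "'u set \<Rightarrow> 'a set \<Rightarrow> ('a \<Rightarrow> 'u set) set \<Rightarrow> 'a \<Rightarrow> 'u set" where
  "soft_Inter U A \<F> = (\<lambda>p\<in>A. U \<inter> (\<Inter>F\<in>\<F>. F p))"

definition soft_topology :: "'u set \<Rightarrow> 'a set \<Rightarrow> ('a \<Rightarrow> 'u set) set \<Rightarrow> bool" where
  "soft_topology U A \<tau> \<longleftrightarrow>
     \<tau> \<subseteq> soft_sets U A \<and>
     null_soft A \<in> \<tau> \<and> full_soft U A \<in> \<tau> \<and>
     (\<forall>\<F>. \<F> \<subseteq> \<tau> \<longrightarrow> soft_Union A \<F> \<in> \<tau>) \<and>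
     (\<forall>F\<in>\<tau>. \<forall>G\<in>\<tau>. soft_inter A F G \<in> \<tau>)"

definition closed_soft_sets ::
    "'u set \<Rightarrow> 'a set \<Rightarrow> ('a \<Rightarrow> 'u set) set \<Rightarrow> ('a \<Rightarrow> 'u set) set" where
  "closed_soft_sets U A \<tau> = soft_compl U A ` \<tau>"

definition soft_closure ::
    "'u set \<Rightarrow> 'a set \<Rightarrow> ('a \<Rightarrow> 'u set) set \<Rightarrow> ('a \<Rightarrow> 'u set) \<Rightarrow> 'a \<Rightarrow> 'u set" where
  "soft_closure U A \<tau> F = soft_Inter U A {K \<in> closed_soft_sets U A \<tau>. soft_subset A F K}"

definition soft_interior ::
    "'a set \<Rightarrow> ('a \<Rightarrow> 'u set) set \<Rightarrow> ('a \<Rightarrow> 'u set) \<Rightarrow> 'a \<Rightarrow> 'u set" where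
  "soft_interior A \<tau> F = soft_Union A {H \<in> \<tau>. soft_subset A H F}"

definition soft_semiopen ::
    "'u set \<Rightarrow> 'a set \<Rightarrow> ('a \<Rightarrow> 'u set) set \<Rightarrow> ('a \<Rightarrow> 'u set) \<Rightarrow> bool" where
  "soft_semiopen U A \<tau> G \<longleftrightarrow> G \<in> soft_sets U A \<and>
     (\<exists>H\<in>\<tau>. soft_subset A H G \<and> soft_subset A G (soft_closure U A \<tau> H))"

definition soft_semiclosed ::
    "'u set \<Rightarrow> 'a set \<Rightarrow> ('a \<Rightarrow> 'u set) set \<Rightarrow> ('a \<Rightarrow> 'u set) \<Rightarrow> bool" where
  "soft_semiclosed U A \<tau> F \<longleftrightarrow> F \<in> soft_sets U A \<and>
     (\<exists>K\<in>closed_soft_sets U A \<tau>. soft_subset A (soft_interior A \<tau> K) F \<and> soft_subset A F K)"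

end

theory Submission
  imports Defs
begin

text \<open>
  The proof rests on duality: soft complementation is an inclusion-reversing involution on soft
  sets which exchanges open with closed soft sets, hence interior with closure
  (\<open>soft_closure_compl\<close>, \<open>soft_interior_compl\<close>) and semiclosed with semiopen soft sets
  (\<open>soft_semiclosed_iff_semiopen_compl\<close>). Hence the first and last conditions are equivalent, and
  complementing both sides of the second inclusion gives the third. The only topological
  ingredient is that a soft set \<open>F\<close> is semiopen iff it lies in the closure of its interior
  (\<open>soft_semiopen_iff\<close>): the interior of \<open>F\<close> is the largest open soft set inside \<open>F\<close>, so by
  monotonicity of closure it is the best possible witness. This links the third condition to
  the fourth.
\<close>

lemma soft_topology_soft_sets:
  "soft_topology U A \<tau> \<Longrightarrow> H \<in> \<tau> \<Longrightarrow> H \<in> soft_sets U A"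
  by (auto simp: soft_topology_def)

lemma soft_sets_mem: "F \<in> soft_sets U A \<Longrightarrow> p \<in> A \<Longrightarrow> F p \<subseteq> U"
  by (auto simp: soft_sets_def)

lemma soft_compl_in_soft_sets: "soft_compl U A F \<in> soft_sets U A"
  by (auto simp: soft_sets_def soft_compl_def)

lemma soft_compl_compl:
  assumes "F \<in> soft_sets U A"
  shows "soft_compl U A (soft_compl U A F) = F"
proof (rule extensionalityI[where A = A])
  show "F \<in> extensional A"
    using assms by (auto simp: soft_sets_def PiE_def)
qed (use soft_sets_mem[OF assms] in \<open>auto simp: soft_compl_def\<close>)

lemma soft_subset_trans:
  "soft_subset A F G \<Longrightarrow> soft_subset A G H \<Longrightarrow> soft_subset A F H"
  unfolding soft_subset_def by blast

lemma soft_subset_compl_iff: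
  assumes "F \<in> soft_sets U A"
  shows "soft_subset A (soft_compl U A G) (soft_compl U A F) \<longleftrightarrow> soft_subset A F G"
  using soft_sets_mem[OF assms] by (fastforce simp: soft_subset_def soft_compl_def)

lemma soft_interior_open:
  "soft_topology U A \<tau> \<Longrightarrow> soft_interior A \<tau> F \<in> \<tau>"
  by (auto simp: soft_topology_def soft_interior_def)

lemma soft_interior_subset: "soft_subset A (soft_interior A \<tau> F) F"
  by (auto simp: soft_interior_def soft_Union_def soft_subset_def)

lemma soft_interior_maximal:
  "H \<in> \<tau> \<Longrightarrow> soft_subset A H F \<Longrightarrow> soft_subset A H (soft_interior A \<tau> F)"
  by (auto simp: soft_interior_def soft_Union_def soft_subset_def)

lemma soft_closure_in_soft_sets: "soft_closure U A \<tau> F \<in> soft_sets U A"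
  by (auto simp: soft_closure_def soft_Inter_def soft_sets_def)

lemma soft_closure_mono:
  assumes "soft_subset A F G"
  shows "soft_subset A (soft_closure U A \<tau> F) (soft_closure U A \<tau> G)"
  using soft_subset_trans[OF assms]
  by (fastforce simp: soft_closure_def soft_Inter_def soft_subset_def[of A "restrict _ _"])

lemma soft_closure_compl:
  assumes "soft_topology U A \<tau>"
  shows "soft_closure U A \<tau> (soft_compl U A F) = soft_compl U A (soft_interior A \<tau> F)"
proof -
  have "{K \<in> closed_soft_sets U A \<tau>. soft_subset A (soft_compl U A F) K}
      = soft_compl U A ` {H \<in> \<tau>. soft_subset A H F}"
    using soft_subset_compl_iff[OF soft_topology_soft_sets[OF assms]]
    by (auto simp: closed_soft_sets_def)
  then show ?thesis
    unfolding soft_closure_def soft_interior_def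
    by (auto simp: soft_Inter_def soft_Union_def soft_compl_def fun_eq_iff)
qed

lemma soft_interior_compl:
  assumes "soft_topology U A \<tau>" and "F \<in> soft_sets U A"
  shows "soft_interior A \<tau> (soft_compl U A F) = soft_compl U A (soft_closure U A \<tau> F)"
proof -
  have "soft_interior A \<tau> (soft_compl U A F)
      = soft_compl U A (soft_compl U A (soft_interior A \<tau> (soft_compl U A F)))"
    using soft_compl_compl[OF soft_topology_soft_sets[OF assms(1) soft_interior_open[OF assms(1)]]]
    by simp
  also have "\<dots> = soft_compl U A (soft_closure U A \<tau> F)"
    by (simp add: soft_closure_compl[OF assms(1), symmetric] soft_compl_compl[OF assms(2)])
  finally show ?thesis .
qed

lemma soft_semiopen_iff:
  assumes "soft_topology U A \<tau>" and "F \<in> soft_sets U A"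
  shows "soft_semiopen U A \<tau> F \<longleftrightarrow> soft_subset A F (soft_closure U A \<tau> (soft_interior A \<tau> F))"
proof
  assume "soft_semiopen U A \<tau> F"
  then obtain H where "H \<in> \<tau>" "soft_subset A H F" "soft_subset A F (soft_closure U A \<tau> H)"
    by (auto simp: soft_semiopen_def)
  then show "soft_subset A F (soft_closure U A \<tau> (soft_interior A \<tau> F))"
    by (blast intro: soft_subset_trans soft_closure_mono soft_interior_maximal)
next
  assume "soft_subset A F (soft_closure U A \<tau> (soft_interior A \<tau> F))"
  then show "soft_semiopen U A \<tau> F"
    using assms(2) soft_interior_open[OF assms(1)] soft_interior_subset
    unfolding soft_semiopen_def by blast
qed

lemma soft_semiclosed_iff_semiopen_compl:
  assumes "soft_topology U A \<tau>" and "G \<in> soft_sets U A"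
  shows "soft_semiclosed U A \<tau> G \<longleftrightarrow> soft_semiopen U A \<tau> (soft_compl U A G)"
proof -
  \<comment> \<open>An open \<open>H\<close> witnesses that the complement of \<open>G\<close> is semiopen iff its complement
    witnesses that \<open>G\<close> is semiclosed.\<close>
  have "soft_subset A (soft_interior A \<tau> (soft_compl U A H)) G
          \<longleftrightarrow> soft_subset A (soft_compl U A G) (soft_closure U A \<tau> H)"
    and "soft_subset A G (soft_compl U A H) \<longleftrightarrow> soft_subset A H (soft_compl U A G)"
    if "H \<in> \<tau>" for H
  proof -
    have H: "H \<in> soft_sets U A"
      by (rule soft_topology_soft_sets[OF assms(1) that])
    show "soft_subset A (soft_interior A \<tau> (soft_compl U A H)) G
          \<longleftrightarrow> soft_subset A (soft_compl U A G) (soft_closure U A \<tau> H)"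
      using soft_subset_compl_iff[where F = "soft_compl U A (soft_closure U A \<tau> H)" and G = G,
          OF soft_compl_in_soft_sets]
      by (simp add: soft_interior_compl[OF assms(1) H]
          soft_compl_compl[OF soft_closure_in_soft_sets])
    show "soft_subset A G (soft_compl U A H) \<longleftrightarrow> soft_subset A H (soft_compl U A G)"
      using soft_subset_compl_iff[OF H, of "soft_compl U A G"]
      by (simp add: soft_compl_compl[OF assms(2)])
  qed
  then show ?thesis
    using assms(2)
    by (auto simp: soft_semiclosed_def soft_semiopen_def closed_soft_sets_def
        soft_compl_in_soft_sets)
qed

theorem theorem2p12:
  fixes U :: "'u set" and A :: "'a set" and \<tau> :: "('a \<Rightarrow> 'u set) set" and G :: "'a \<Rightarrow> 'u set"
  assumes "soft_topology U A \<tau>"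
    and "G \<in> soft_sets U A"
  shows "(soft_semiclosed U A \<tau> G
            \<longleftrightarrow> soft_subset A (soft_interior A \<tau> (soft_closure U A \<tau> G)) G)
       \<and> (soft_subset A (soft_interior A \<tau> (soft_closure U A \<tau> G)) G
            \<longleftrightarrow> soft_subset A (soft_compl U A G)
                  (soft_closure U A \<tau> (soft_interior A \<tau> (soft_compl U A G))))
       \<and> (soft_subset A (soft_compl U A G)
                  (soft_closure U A \<tau> (soft_interior A \<tau> (soft_compl U A G)))
            \<longleftrightarrow> soft_semiopen U A \<tau> (soft_compl U A G))"
proof -
  let ?I = "soft_interior A \<tau> (soft_closure U A \<tau> G)"
  have "?I \<in> soft_sets U A"
    by (rule soft_topology_soft_sets[OF assms(1) soft_interior_open[OF assms(1)]])
  then have "soft_subset A ?I G \<longleftrightarrow> soft_subset A (soft_compl U A G) (soft_compl U A ?I)"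
    by (simp add: soft_subset_compl_iff)
  also have "soft_compl U A ?I
      = soft_closure U A \<tau> (soft_interior A \<tau> (soft_compl U A G))"
    by (simp add: soft_closure_compl[OF assms(1)] soft_interior_compl[OF assms])
  finally show ?thesis
    using soft_semiopen_iff[OF assms(1) soft_compl_in_soft_sets]
      soft_semiclosed_iff_semiopen_compl[OF assms] by blast
qed

end
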